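(* As $n\to\infty$, $$s(n)\le \frac{19}{6\ln 3}\,n\ln n+O(n).$$
   Context: A graph $G$ is universal for a class of graphs $\mathcal C$ if, up to isomorphism, $G$ contains every graph in $\mathcal C$ as a (not necessarily induced) subgraph. For $n\in\mathbb N$, $s(n)$ denotes the minimum number of edges in a graph with $n$ vertices that is universal for the class of all trees with $n$ vertices. *)

theory Defs
  imports Complex_Main "HOL-Library.Landau_Symbols"
begin

type_synonym 'a graph = "'a set \<times> 'a set set"

abbreviation verts :: "'a graph \<Rightarrow> 'a set" where "verts \<equiv> fst"
abbreviation edges :: "'a graph \<Rightarrow> 'a set set" where "edges \<equiv> snd"

definition simple_graph :: "'a graph \<Rightarrow> bool" where
  "simple_graph G \<longleftrightarrow> finite (verts G) \<and>
     edges G \<subseteq> {{u, v} | u v. u \<in> verts G \<and> v \<in> verts G \<and> u \<noteq> v}"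

definition subgraph :: "'a graph \<Rightarrow> 'a graph \<Rightarrow> bool" where
  "subgraph H G \<longleftrightarrow> simple_graph H \<and> simple_graph G \<and>
     verts H \<subseteq> verts G \<and> edges H \<subseteq> edges G"

definition isomorphic :: "'a graph \<Rightarrow> 'b graph \<Rightarrow> bool" where
  "isomorphic G H \<longleftrightarrow> (\<exists>f. bij_betw f (verts G) (verts H) \<and>
     (\<forall>u\<in>verts G. \<forall>v\<in>verts G. {u, v} \<in> edges G \<longleftrightarrow> {f u, f v} \<in> edges H))"

definition universal :: "'a graph \<Rightarrow> 'b graph set \<Rightarrow> bool" where
  "universal G C \<longleftrightarrow> (\<forall>H\<in>C. \<exists>S. subgraph S G \<and> isomorphic H S)"

text \<open>Walks and cycles are given by their vertex sequences; in a cycle the first vertex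
  is not repeated at the end.\<close>

definition walk :: "'a graph \<Rightarrow> 'a list \<Rightarrow> bool" where
  "walk G p \<longleftrightarrow> p \<noteq> [] \<and> set p \<subseteq> verts G \<and> successively (\<lambda>u v. {u, v} \<in> edges G) p"

definition connected_graph :: "'a graph \<Rightarrow> bool" where
  "connected_graph G \<longleftrightarrow> verts G \<noteq> {} \<and>
     (\<forall>u\<in>verts G. \<forall>v\<in>verts G. \<exists>p. walk G p \<and> hd p = u \<and> last p = v)"

definition cycle :: "'a graph \<Rightarrow> 'a list \<Rightarrow> bool" where
  "cycle G p \<longleftrightarrow> walk G p \<and> 3 \<le> length p \<and> distinct p \<and> {last p, hd p} \<in> edges G"

definition tree :: "'a graph \<Rightarrow> bool" where
  "tree G \<longleftrightarrow> simple_graph G \<and> connected_graph G \<and> \<not> (\<exists>p. cycle G p)"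

text \<open>Every finite graph is isomorphic to one whose vertices are natural numbers, so
  nothing is lost by taking the vertices, both of the trees and of the universal graph,
  from \<^typ>\<open>nat\<close>. The empty graph is not a tree.\<close>

definition trees :: "nat \<Rightarrow> nat graph set" where
  "trees n = {T. tree T \<and> card (verts T) = n}"

definition min_universal_edges :: "nat \<Rightarrow> nat" where
  "min_universal_edges n = (LEAST m. \<exists>G :: nat graph.
     simple_graph G \<and> card (verts G) = n \<and> universal G (trees n) \<and> card (edges G) = m)"

text \<open>The minimum is over a nonempty set, as complete graphs are universal.\<close>

lemma universal_graph_exists:
  "\<exists>G :: nat graph. simple_graph G \<and> card (verts G) = n \<and> universal G (trees n)"
proof -
  let ?G = "({..<n}, {{u, v} | u v. u \<in> {..<n} \<and> v \<in> {..<n} \<and> u \<noteq> v}) :: nat graph"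
  have G: "simple_graph ?G" "card (verts ?G) = n"
    by (auto simp: simple_graph_def)
  have "\<exists>S. subgraph S ?G \<and> isomorphic T S" if "T \<in> trees n" for T
  proof -
    from that have T: "simple_graph T" "card (verts T) = n"
      by (auto simp: trees_def tree_def)
    then have "finite (verts T)"
      by (simp add: simple_graph_def)
    with T(2) obtain f where f: "bij_betw f (verts T) {..<n}"
      by (metis card_lessThan finite_lessThan finite_same_card_bij)
    let ?S = "({..<n}, (\<lambda>e. f ` e) ` edges T)"
    have inj: "inj_on f (verts T)" and im: "f ` verts T = {..<n}"
      using f by (auto simp: bij_betw_def)
    have sub: "e \<subseteq> verts T" if "e \<in> edges T" for e
      using that T(1) by (auto simp: simple_graph_def)
    have E: "f ` e \<in> {{u, v} | u v. u \<in> {..<n} \<and> v \<in> {..<n} \<and> u \<noteq> v}"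
      if e: "e \<in> edges T" for e
    proof -
      obtain u v where "e = {u, v}" "u \<in> verts T" "v \<in> verts T" "u \<noteq> v"
        using subsetD[OF conjunct2[OF T(1)[unfolded simple_graph_def]] e] by blast
      moreover from this have "f u \<noteq> f v" "f u \<in> {..<n}" "f v \<in> {..<n}"
        using inj im by (auto dest: inj_onD)
      ultimately show ?thesis
        by auto
    qed
    have "subgraph ?S ?G"
      using E G(1) by (auto simp: subgraph_def simple_graph_def)
    moreover have "{u, v} \<in> edges T \<longleftrightarrow> {f u, f v} \<in> edges ?S"
      if uv: "u \<in> verts T" "v \<in> verts T" for u v
    proof
      assume "{u, v} \<in> edges T"
      then have "f ` {u, v} \<in> (\<lambda>e. f ` e) ` edges T"
        by (rule imageI)
      then show "{f u, f v} \<in> edges ?S"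
        by simp
    next
      assume "{f u, f v} \<in> edges ?S"
      then obtain e where e: "e \<in> edges T" "f ` e = f ` {u, v}"
        by auto
      then have "e = {u, v}"
        using inj_on_image_eq_iff[OF inj sub[OF e(1)], of "{u, v}"] uv by simp
      then show "{u, v} \<in> edges T"
        using e by simp
    qed
    then have "isomorphic T ?S"
      using f unfolding isomorphic_def by (intro exI[of _ f]) simp
    ultimately show ?thesis
      by blast
  qed
  then show ?thesis
    using G unfolding universal_def by blast
qed

end

theory Submission
  imports Defs
begin

text \<open>Place the vertices of the graph on the positions \<open>0, \<dots>, n - 1\<close>, cut the line into thirds of
  length \<open>m\<close>, and recurse so that every forest fits into every interval of its own size. An
  interval crossing a cut \<open>q\<close> is filled as follows: a well-chosen vertex \<open>v\<close> of the forest goes to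
  \<open>q\<close>, which is joined to the whole interval; the remaining components are grouped into a part
  filling the left end of the interval, a part filling the right end, and a small part \<open>K\<close>
  around \<open>q\<close>, which is treated in the same way with the next key \<open>q + 1\<close>, then \<open>q + 2\<close>, and so on.
  If \<open>a\<close> positions lie to the left of the key and \<open>b\<close> to the right, the greedy grouping leaves \<open>l\<close>
  and \<open>r\<close> positions to \<open>K\<close> with \<open>2 l + r \<le> a\<close>, and if \<open>a, b \<le> M\<close> one can achieve
  \<open>l, r \<le> M / 2\<close>. At the second cut the keys thus need \<open>2 (m + m/2 + m/4 + \<dots>) = 4 m\<close> edges; at the
  first one they need \<open>3 m\<close>, then \<open>m/2 + m\<close>, and then \<open>2 (m/4 + m/8 + \<dots>) = m\<close>. These
  \<open>19/2 m\<close> edges are \<open>19/6\<close> per position on each of the \<open>log\<^sub>3 n\<close> levels of the recursion.\<close>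

section \<open>Forests, splittings at a vertex, and gluing of embeddings\<close>

text \<open>A forest on \<open>W\<close> is encoded by a function \<open>p\<close>: its edges are the pairs \<open>{u, p u}\<close> with
  \<open>p u \<in> W\<close> and \<open>p u < u\<close>, other values of \<open>p\<close> being ignored. So a subset of \<open>W\<close> needs no new \<open>p\<close>.\<close>

definition embeds :: "nat set set \<Rightarrow> (nat \<Rightarrow> nat) \<Rightarrow> nat set \<Rightarrow> (nat \<Rightarrow> nat) \<Rightarrow> nat set \<Rightarrow> bool" where
  "embeds E p W f X \<longleftrightarrow> bij_betw f W X \<and> (\<forall>u\<in>W. p u \<in> W \<and> p u < u \<longrightarrow> {f u, f (p u)} \<in> E)"

text \<open>The set \<open>W\<close> is arbitrary rather than an initial segment, so the property
  applies directly to the parts of a splitting, which keep their vertices and their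
  \<open>p\<close>.\<close>

definition full :: "nat set set \<Rightarrow> nat set \<Rightarrow> bool" where
  "full E X \<longleftrightarrow> (\<forall>p W. finite W \<and> card W = card X \<longrightarrow> (\<exists>f. embeds E p W f X))"

text \<open>For \<open>X \<subseteq> W - {v}\<close> this says that \<open>X\<close> is a union of
  components of the forest on \<open>W\<close> without \<open>v\<close>.\<close>

definition detached :: "(nat \<Rightarrow> nat) \<Rightarrow> nat set \<Rightarrow> nat \<Rightarrow> nat set \<Rightarrow> bool" where
  "detached p W v X \<longleftrightarrow> (\<forall>u\<in>W - {v}. p u \<in> W - {v} \<and> p u < u \<longrightarrow> (u \<in> X \<longleftrightarrow> p u \<in> X))"

text \<open>The vertex \<open>v\<close> is meant for the key, \<open>A\<close> and \<open>B\<close>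
  for the left and the right end of the interval, \<open>K\<close> for the positions next to the
  key. Each part may be empty.\<close>

definition splitting ::
  "(nat \<Rightarrow> nat) \<Rightarrow> nat set \<Rightarrow> nat \<Rightarrow> nat set \<Rightarrow> nat set \<Rightarrow> nat set \<Rightarrow> bool" where
  "splitting p W v A K B \<longleftrightarrow> W = insert v (A \<union> K \<union> B) \<and> v \<notin> A \<union> K \<union> B \<and>
     A \<inter> K = {} \<and> A \<inter> B = {} \<and> K \<inter> B = {} \<and>
     detached p W v A \<and> detached p W v K \<and> detached p W v B"

lemma splitting_swap: "splitting p W v A K B \<Longrightarrow> splitting p W v B K A"
  unfolding splitting_def by blast

lemma detached_Un: "detached p W v X \<Longrightarrow> detached p W v Y \<Longrightarrow> detached p W v (X \<union> Y)"
  unfolding detached_def by blast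

lemma detached_Union: "(\<And>X. X \<in> P \<Longrightarrow> detached p W v X) \<Longrightarrow> detached p W v (\<Union>P)"
  unfolding detached_def by blast

lemma detached_rest: "detached p W v X \<Longrightarrow> detached p W v (W - {v} - X)"
  unfolding detached_def by blast

lemma splitting_rest:
  assumes "v \<in> W" "A \<subseteq> W - {v}" "C \<subseteq> W - {v}" "A \<inter> C = {}" "detached p W v A" "detached p W v C"
  shows "splitting p W v A C (W - {v} - (A \<union> C))" "splitting p W v A (W - {v} - (A \<union> C)) C"
  using assms detached_rest[OF detached_Un[OF assms(5,6)]] unfolding splitting_def by blast+

text \<open>An edge at \<open>v\<close> is mapped into the star of \<open>x\<close>. Any other edge
  stays within one part, since the parts are detached, and is handled by the embedding of that
  part.\<close>

lemma embeds_glue: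
  assumes S: "splitting p W v A K B"
    and f: "embeds E p A f XA" and g: "embeds E p K g XK" and h: "embeds E p B h XB"
    and x: "x \<notin> XA \<union> XK \<union> XB"
    and disj: "XA \<inter> XK = {}" "XA \<inter> XB = {}" "XK \<inter> XB = {}"
    and star: "\<And>y. y \<in> XA \<union> XK \<union> XB \<Longrightarrow> {x, y} \<in> E"
  shows "\<exists>F. embeds E p W F (insert x (XA \<union> XK \<union> XB))"
proof -
  define F where "F u = (if u = v then x else if u \<in> A then f u else if u \<in> K then g u else h u)" for u
  have W: "W = insert v (A \<union> K \<union> B)" and v: "v \<notin> A \<union> K \<union> B"
    and D: "A \<inter> K = {}" "A \<inter> B = {}" "K \<inter> B = {}"
    and det: "detached p W v A" "detached p W v K" "detached p W v B"
    using S by (auto simp: splitting_def)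
  have A: "bij_betw F A XA"
    using f v unfolding embeds_def by (subst bij_betw_cong[of _ _ f]) (auto simp: F_def)
  have K: "bij_betw F K XK"
    using g v D unfolding embeds_def by (subst bij_betw_cong[of _ _ g]) (auto simp: F_def)
  have B: "bij_betw F B XB"
    using h v D unfolding embeds_def by (subst bij_betw_cong[of _ _ h]) (auto simp: F_def)
  have AKB: "bij_betw F (A \<union> K \<union> B) (XA \<union> XK \<union> XB)"
    by (intro bij_betw_combine A K B) (use disj in auto)
  have "bij_betw F ({v} \<union> (A \<union> K \<union> B)) ({x} \<union> (XA \<union> XK \<union> XB))"
    by (intro bij_betw_combine AKB) (use x in \<open>auto simp: F_def\<close>)
  then have bij: "bij_betw F W (insert x (XA \<union> XK \<union> XB))"
    by (simp add: W)
  have "{F u, F (p u)} \<in> E" if u: "u \<in> W" "p u \<in> W" "p u < u" for u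
  proof (cases "u = v \<or> p u = v")
    case True
    then show ?thesis
    proof
      assume "u = v"
      moreover from this have "p u \<in> A \<union> K \<union> B"
        using u W by auto
      ultimately show ?thesis
        using star bij_betwE[OF AKB] by (auto simp: F_def)
    next
      assume "p u = v"
      moreover from this have "u \<in> A \<union> K \<union> B"
        using u W by auto
      ultimately have "{x, F u} \<in> E" "F (p u) = x"
        using star bij_betwE[OF AKB] by (auto simp: F_def)
      then show ?thesis
        by (simp add: insert_commute)
    qed
  next
    case False
    then have in3: "u \<in> A \<union> K \<union> B"
      using u W by auto
    have iff: "u \<in> A \<longleftrightarrow> p u \<in> A" "u \<in> K \<longleftrightarrow> p u \<in> K" "u \<in> B \<longleftrightarrow> p u \<in> B"
      using det False u unfolding detached_def by blast+
    consider "u \<in> A" | "u \<in> K" | "u \<in> B"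
      using in3 by blast
    then show ?thesis
    proof cases
      case 1
      then show ?thesis
        using f iff False u(3) by (simp add: F_def embeds_def)
    next
      case 2
      then have "u \<notin> A" "p u \<notin> A"
        using iff D by auto
      with 2 show ?thesis
        using g iff False u(3) by (simp add: F_def embeds_def)
    next
      case 3
      then have "u \<notin> A" "p u \<notin> A" "u \<notin> K" "p u \<notin> K"
        using iff D by auto
      with 3 show ?thesis
        using h iff False u(3) by (simp add: F_def embeds_def)
    qed
  qed
  with bij show ?thesis
    unfolding embeds_def by blast
qed

section \<open>Finding splittings: branches at a vertex and their greedy grouping\<close>

text \<open>Take for \<open>v\<close> the largest vertex with more than \<open>a\<close>
  descendants, counting itself, and for \<open>P\<close> the descendant sets of its children.
  Parents are smaller than their children, so by maximality each child has at most \<open>a\<close>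
  descendants; without \<open>v\<close> itself, at least \<open>a\<close> descendants of
  \<open>v\<close> remain to be covered by \<open>P\<close>.\<close>

lemma branches_at_vertex:
  fixes p :: "nat \<Rightarrow> nat"
  assumes fin: "finite W" and a: "a < card W"
  obtains v P where "v \<in> W" "finite P" "pairwise disjnt P" "\<Union>P \<subseteq> W - {v}"
    "\<forall>X\<in>P. detached p W v X \<and> card X \<le> a" "a \<le> (\<Sum>X\<in>P. card X)"
proof -
  define m where "m = Min W"
  have ne: "W \<noteq> {}"
    using a by auto
  have mW: "m \<in> W" and m_le: "\<And>w. w \<in> W \<Longrightarrow> m \<le> w"
    using fin ne by (auto simp: m_def)
  \<comment> \<open>the roots are attached to \<open>m\<close>, which turns the forest into a tree\<close>
  define p' where "p' u = (if p u \<in> W \<and> p u < u then p u else m)" for u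
  have p'W: "p' u \<in> W" for u
    using mW by (auto simp: p'_def)
  have p'_less: "p' u < u" if "u \<in> W" "u \<noteq> m" for u
    using that m_le[of u] by (auto simp: p'_def)
  have p'_m: "p' m = m"
    using m_le by (auto simp: p'_def dest: leD)
  have p'_le: "p' u \<le> u" if "u \<in> W" for u
    using that p'_less[of u] p'_m by (cases "u = m") auto
  have it_le: "(p' ^^ k) u \<le> u \<and> (p' ^^ k) u \<in> W" if "u \<in> W" for k u
    by (induction k) (use that p'_le p'W in \<open>auto intro: le_trans\<close>)
  \<comment> \<open>These are the descendants of \<open>c\<close>, including
    \<open>c\<close>.\<close>
  define D where "D c = {w \<in> W. \<exists>k. (p' ^^ k) w = c}" for c
  have D_sub: "D c \<subseteq> W" for c
    by (auto simp: D_def)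
  have finD: "finite (D c)" for c
    using D_sub fin finite_subset by blast
  have D_step: "w \<in> D c" if w: "p' w \<in> D c" "w \<in> W" for w c
  proof -
    obtain k where "(p' ^^ k) (p' w) = c"
      using w(1) unfolding D_def by blast
    then have "(p' ^^ Suc k) w = c"
      by (simp add: funpow_swap1)
    then show ?thesis
      using w(2) unfolding D_def by blast
  qed
  have D_self: "c \<in> D c" if "c \<in> W" for c
    using that by (auto simp: D_def intro: exI[of _ 0])
  have D_inv: "w = c \<or> p' w \<in> D c" if w: "w \<in> D c" for w c
  proof -
    obtain k where k: "(p' ^^ k) w = c"
      using w by (auto simp: D_def)
    show ?thesis
    proof (cases k)
      case 0
      with k show ?thesis by simp
    next
      case (Suc j)
      with k have "(p' ^^ j) (p' w) = c"
        by (simp add: funpow_swap1)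
      then show ?thesis
        using p'W by (auto simp: D_def)
    qed
  qed
  have "w \<in> W \<longrightarrow> w \<in> D m" for w
  proof (induction w rule: less_induct)
    case (less w)
    then show ?case
      using D_self[of m] D_step[of w m] p'_less[of w] p'W mW by (cases "w = m") auto
  qed
  then have Dm: "D m = W"
    using D_sub by blast
  define C where "C = {v \<in> W. a < card (D v)}"
  have finC: "finite C" and "m \<in> C"
    using fin a Dm mW by (auto simp: C_def)
  define v where "v = Max C"
  have vC: "v \<in> C" and v_max: "\<And>c. c \<in> C \<Longrightarrow> c \<le> v"
    using finC \<open>m \<in> C\<close> by (auto simp: v_def intro: Max_in)
  have vW: "v \<in> W" and v_card: "a < card (D v)"
    using vC by (auto simp: C_def)
  \<comment> \<open>The root \<open>m\<close> is its own parent under \<open>p'\<close> and must not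
    become its own child when \<open>v = m\<close>.\<close>
  define Ch where "Ch = {c \<in> W. c \<noteq> m \<and> p' c = v}"
  have Ch_gt: "v < c" if "c \<in> Ch" for c
    using that p'_less by (auto simp: Ch_def)
  have Ch_W: "c \<in> W" if "c \<in> Ch" for c
    using that by (simp add: Ch_def)
  have cover: "w = v \<or> (\<exists>c\<in>Ch. w \<in> D c)" if "(p' ^^ k) w = v" "w \<in> W" for k w
    using that
  proof (induction k arbitrary: w)
    case 0
    then show ?case by simp
  next
    case (Suc k)
    have "(p' ^^ k) (p' w) = v"
      using Suc.prems(1) by (simp add: funpow_swap1)
    then consider "p' w = v" | c where "c \<in> Ch" "p' w \<in> D c"
      using Suc.IH p'W by blast
    then show ?case
    proof cases
      case 1
      then show ?thesis
        using p'_m D_self Suc.prems(2) by (cases "w = m") (auto simp: Ch_def)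
    next
      case 2
      then show ?thesis
        using D_step Suc.prems(2) by blast
    qed
  qed
  show ?thesis
  proof (rule that)
    show "v \<in> W" by (fact vW)
    show finP: "finite (D ` Ch)"
      using fin by (simp add: Ch_def)
    \<comment> \<open>If two distinct children of \<open>v\<close> lay on one chain of ancestors,
      the upper one would be an ancestor of \<open>v\<close> or \<open>v\<close> itself, although
      children are larger than \<open>v\<close>.\<close>
    have apart: "False" if c: "c \<in> Ch" "d \<in> Ch" "c \<noteq> d" and w: "w \<in> W"
      "(p' ^^ i) w = c" "(p' ^^ j) w = d" "i \<le> j" for c d w i j
    proof -
      have "i < j"
        using that by (metis le_neq_implies_less)
      then obtain k where "j = Suc k + i"
        by (metis add.commute less_imp_add_positive gr0_implies_Suc)
      then have "(p' ^^ Suc k) c = d"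
        using w by (metis comp_apply funpow_add)
      then have "(p' ^^ k) v = d"
        using c(1) by (simp add: funpow_swap1 Ch_def)
      then have "d \<le> v"
        using it_le[OF vW] by metis
      then show False
        using Ch_gt[OF c(2)] by simp
    qed
    show "pairwise disjnt (D ` Ch)"
    proof (rule pairwiseI)
      fix X Y assume "X \<in> D ` Ch" "Y \<in> D ` Ch" "X \<noteq> Y"
      then obtain c d where cd: "c \<in> Ch" "d \<in> Ch" "c \<noteq> d" and XY: "X = D c" "Y = D d"
        by blast
      have False if w: "w \<in> X" "w \<in> Y" for w
      proof -
        obtain i j where "(p' ^^ i) w = c" "(p' ^^ j) w = d" "w \<in> W"
          using w XY by (auto simp: D_def)
        then show False
          using apart[of c d w i j] apart[of d c w j i] cd by (cases "i \<le> j") auto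
      qed
      then show "disjnt X Y"
        by (auto simp: disjnt_def)
    qed
    have v_notin: "v \<notin> D c" if "c \<in> Ch" for c
    proof
      assume "v \<in> D c"
      then obtain k where "(p' ^^ k) v = c"
        by (auto simp: D_def)
      then show False
        using it_le[OF vW, of k] Ch_gt[OF that] by simp
    qed
    then show "\<Union> (D ` Ch) \<subseteq> W - {v}"
      using D_sub by blast
    show "\<forall>X\<in>D ` Ch. detached p W v X \<and> card X \<le> a"
    proof
      fix X assume X: "X \<in> D ` Ch"
      obtain c where c: "c \<in> Ch" and Xc: "X = D c"
        using X by blast
      have "c \<notin> C"
        using v_max Ch_gt[OF c] by force
      then have "card X \<le> a"
        using Ch_W[OF c] by (auto simp: Xc C_def)
      moreover have "u \<in> X \<longleftrightarrow> p u \<in> X"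
        if u: "u \<in> W - {v}" "p u \<in> W - {v}" "p u < u" for u
      proof -
        have pu: "p' u = p u"
          using u by (simp add: p'_def)
        have "u \<noteq> c"
          using u pu c by (auto simp: Ch_def)
        then show ?thesis
          using D_inv[of u c] D_step[of u c] u pu by (auto simp: Xc)
      qed
      ultimately show "detached p W v X \<and> card X \<le> a"
        by (auto simp: detached_def)
    qed
    have "D v \<subseteq> insert v (\<Union> (D ` Ch))"
      using cover by (auto simp: D_def)
    then have "card (D v) \<le> card (insert v (\<Union> (D ` Ch)))"
      by (intro card_mono) (use finP finD in auto)
    also have "\<dots> \<le> Suc (card (\<Union> (D ` Ch)))"
      by (rule card_insert_le_m1) auto
    also have "card (\<Union> (D ` Ch)) \<le> (\<Sum>X\<in>D ` Ch. card X)"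
      by (rule card_Union_le_sum_card)
    finally show "a \<le> (\<Sum>X\<in>D ` Ch. card X)"
      using v_card by simp
  qed
qed

text \<open>Lightest elements are discarded while the rest still weighs at least \<open>a\<close>.
  If the process does not stop at exactly \<open>a\<close>, the next lightest element
  \<open>k\<close> brings the weight below \<open>a\<close>, and everything left in \<open>Q\<close>
  is at least as heavy as \<open>k\<close>.\<close>

lemma greedy_subset:
  fixes w :: "'a \<Rightarrow> nat"
  assumes "finite P" "a \<le> sum w P"
  shows "\<exists>Q\<subseteq>P. sum w Q \<le> a \<and>
    (sum w Q = a \<or> (\<exists>k\<in>P - Q. a < sum w Q + w k \<and> (\<forall>x\<in>Q. w k \<le> w x)))"
  using assms
proof (induction "card P" arbitrary: P)
  case 0
  then show ?case by auto
next
  case (Suc c)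
  then have "P \<noteq> {}" by auto
  then obtain k where k: "k \<in> P" "\<And>x. x \<in> P \<Longrightarrow> w k \<le> w x"
    using Suc.prems(1) by (metis arg_min_if_finite(1) arg_min_least)
  have sum: "sum w P = sum w (P - {k}) + w k"
    using Suc.prems(1) k(1) by (simp add: sum.remove)
  show ?case
  proof (cases "a \<le> sum w (P - {k})")
    case True
    have "c = card (P - {k})"
      using Suc.hyps(2) Suc.prems(1) k(1) by simp
    from Suc.hyps(1)[OF this _ True] Suc.prems(1) show ?thesis
      by (auto intro: exI)
  next
    case False
    show ?thesis
    proof (cases "sum w P = a")
      case True
      then show ?thesis by auto
    next
      case neq: False
      show ?thesis
        by (intro exI[of _ "P - {k}"] conjI disjI2 bexI[of _ k])
          (use False neq k sum Suc.prems(2) in auto)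
    qed
  qed
qed

text \<open>\<open>A\<close> collects branches greedily, and \<open>K\<close> is a branch that
  overflows: it takes the \<open>l\<close> positions still free on the left and
  \<open>r = card K - l\<close> on the right. As \<open>K\<close> is no larger than some branch in
  \<open>A\<close>, \<open>2 * l + r = l + card K \<le> l + card A = a\<close>. The last clause
  keeps such a branch \<open>X\<close> for the balanced variant.\<close>

lemma greedy_splitting:
  assumes fin: "finite W" and card: "card W = a + b + 1"
  shows "\<exists>v A K B l r. splitting p W v A K B \<and> card A + l = a \<and> card B + r = b \<and>
    2 * l + r \<le> a \<and>
    (K = {} \<or> (\<exists>X\<subseteq>A. card K \<le> card X \<and> card X \<le> a \<and> detached p W v X))"
proof -
  have "a < card W"
    using card by simp
  then obtain v P where v: "v \<in> W" and P: "finite P" "pairwise disjnt P" "\<Union>P \<subseteq> W - {v}"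
    and det: "\<forall>X\<in>P. detached p W v X \<and> card X \<le> a" and sum: "a \<le> (\<Sum>X\<in>P. card X)"
    by (rule branches_at_vertex[OF fin, where p = p])
  obtain Q where Q: "Q \<subseteq> P" "sum card Q \<le> a"
    "sum card Q = a \<or> (\<exists>K\<in>P - Q. a < sum card Q + card K \<and> (\<forall>X\<in>Q. card K \<le> card X))"
    using greedy_subset[OF P(1) sum] by blast
  have finP: "finite X" if "X \<in> P" for X
    using that P(3) by (intro finite_subset[OF _ fin]) auto
  define A where "A = \<Union>Q"
  have cardA: "card A = sum card Q"
    unfolding A_def
  proof (rule card_Union_disjoint)
    show "pairwise disjnt Q"
      by (rule pairwise_subset[OF P(2) Q(1)])
    show "finite X" if "X \<in> Q" for X
      by (rule finP[OF subsetD[OF Q(1) that]])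
  qed
  have A_sub: "A \<subseteq> W - {v}"
    using P(3) Q(1) by (auto simp: A_def)
  have A_det: "detached p W v A"
    unfolding A_def
  proof (rule detached_Union)
    show "detached p W v X" if "X \<in> Q" for X
      using bspec[OF det subsetD[OF Q(1) that]] by (rule conjunct1)
  qed
  have card_rest: "card (W - {v} - (A \<union> K)) = a + b - card A - card K"
    if "K \<subseteq> W - {v}" "A \<inter> K = {}" for K
  proof -
    have "finite A" "finite K"
      using A_sub that by (auto intro: finite_subset[OF _ fin])
    then have "card (W - {v} - (A \<union> K)) = card (W - {v}) - card (A \<union> K)"
      using A_sub that(1) by (intro card_Diff_subset) auto
    then show ?thesis
      using card_Un_disjoint[OF \<open>finite A\<close> \<open>finite K\<close> that(2)] v card by (simp add: card_Diff_singleton)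
  qed
  show ?thesis
  proof (cases "sum card Q = a")
    case True
    have "splitting p W v A {} (W - {v} - (A \<union> {}))"
      by (rule splitting_rest) (use v A_sub A_det in \<open>auto simp: detached_def\<close>)
    moreover have "card (W - {v} - (A \<union> {})) + 0 = b"
      using card_rest[of "{}"] cardA True by simp
    moreover have "card A + 0 = a" "2 * 0 + 0 \<le> a"
      using cardA True by simp_all
    ultimately show ?thesis
      by blast
  next
    case False
    then obtain K where K: "K \<in> P" "K \<notin> Q" "a < sum card Q + card K" "\<And>X. X \<in> Q \<Longrightarrow> card K \<le> card X"
      using Q(3) by blast
    have K_sub: "K \<subseteq> W - {v}"
      using P(3) K(1) by blast
    have AK: "A \<inter> K = {}"
    proof -
      have "disjnt K X" if "X \<in> Q" for X
        by (rule pairwiseD[OF P(2) K(1)]) (use that Q(1) K(2) in auto)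
      then show ?thesis
        by (auto simp: A_def disjnt_def)
    qed
    have K_det: "card K \<le> a" "detached p W v K"
      using bspec[OF det K(1)] by simp_all
    \<comment> \<open>\<open>K\<close> has at most \<open>a\<close> elements and yet does not fit
      next to \<open>A\<close>, so \<open>Q\<close> is not empty.\<close>
    with K(3) have "sum card Q \<noteq> 0"
      by linarith
    then obtain X where X: "X \<in> Q"
      by (metis ex_in_conv sum.empty)
    have XA: "X \<subseteq> A" and "finite A"
      using X A_sub by (auto simp: A_def intro: finite_subset[OF _ fin])
    then have KA: "card K \<le> card A"
      using K(4)[OF X] card_mono[of A X] by linarith
    have S: "splitting p W v A K (W - {v} - (A \<union> K))"
      by (rule splitting_rest) (use v A_sub A_det K_sub AK K_det in auto)
    define l r where "l = a - card A" and "r = card K - l"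
    have "finite (A \<union> K)"
      using A_sub K_sub by (intro finite_subset[OF _ fin]) auto
    moreover have "A \<union> K \<subseteq> W - {v}"
      using A_sub K_sub by blast
    ultimately have "card A + card K \<le> a + b"
      using card_mono[of "W - {v}" "A \<union> K"] card_Un_disjoint[OF _ _ AK] fin v card by simp
    then have "card (W - {v} - (A \<union> K)) + r = b"
      using card_rest[OF K_sub AK] K(3) cardA Q(2) by (simp add: l_def r_def)
    moreover have "card A + l = a" "2 * l + r \<le> a"
      using cardA Q(2) KA K(3) by (auto simp: l_def r_def)
    moreover have "card X \<le> a \<and> detached p W v X"
      using bspec[OF det subsetD[OF Q(1) X]] by simp
    ultimately show ?thesis
      using S XA K(4)[OF X] by blast
  qed
qed

lemma unbalanced_splitting:
  assumes "finite W" "card W = a + b + 1"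
  obtains v A K B l r where "splitting p W v A K B" "card A + l = a" "card B + r = b" "2 * l + r \<le> a"
  using greedy_splitting[OF assms, of p] by metis

text \<open>The assumption \<open>a \<le> b\<close> gives
  \<open>card K \<le> card X \<le> a \<le> b\<close>, so that \<open>K\<close> fits on the right
  when \<open>X\<close> is placed on the left.\<close>

lemma balanced_splitting_aux:
  assumes fin: "finite W" and card: "card W = a + b + 1" and ab: "a \<le> b" "b \<le> M"
  shows "\<exists>v A K B l r. splitting p W v A K B \<and> card A + l = a \<and> card B + r = b \<and>
    l \<le> M div 2 \<and> r \<le> M div 2"
proof -
  obtain v A K B l r where S: "splitting p W v A K B" and l: "card A + l = a"
    and r: "card B + r = b" and lr: "2 * l + r \<le> a"
    and X: "K = {} \<or> (\<exists>X\<subseteq>A. card K \<le> card X \<and> card X \<le> a \<and> detached p W v X)"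
    using greedy_splitting[OF fin card, of p] by blast
  have W: "W = insert v (A \<union> K \<union> B)" "v \<notin> A \<union> K \<union> B" "A \<inter> K = {}" "A \<inter> B = {}" "K \<inter> B = {}"
    and Kdet: "detached p W v K"
    using S by (auto simp: splitting_def)
  have finAKB: "finite A" "finite K" "finite B"
    using fin W(1) by auto
  have "card W = 1 + (card A + card K + card B)"
    using W finAKB by (simp add: card_Un_disjoint Int_Un_distrib2)
  then have K: "card K = l + r"
    using card l r by simp
  \<comment> \<open>if \<open>K\<close> is large, then so is \<open>X\<close>, and these two can be the end parts instead\<close>
  show ?thesis
  proof (cases "card K \<le> M div 2")
    case True
    with K have "l \<le> M div 2" "r \<le> M div 2"
      by linarith+
    with S l r show ?thesis
      by blast
  next
    case False
    then obtain X where X: "X \<subseteq> A" "card K \<le> card X" "card X \<le> a" "detached p W v X"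
      using X by auto
    have "splitting p W v X (W - {v} - (X \<union> K)) K"
      by (rule splitting_rest) (use W X Kdet in auto)
    \<comment> \<open>Both \<open>X\<close> and \<open>K\<close> have at least
      \<open>M div 2 + 1\<close> elements, and \<open>M \<le> 2 * (M div 2) + 1\<close>.\<close>
    moreover have "a - card X \<le> M div 2" "b - card K \<le> M div 2"
      using X False ab by linarith+
    moreover have "card X + (a - card X) = a" "card K + (b - card K) = b"
      using X ab by linarith+
    ultimately show ?thesis
      by blast
  qed
qed

lemma balanced_splitting:
  assumes fin: "finite W" and card: "card W = a + b + 1" and ab: "a \<le> M" "b \<le> M"
  shows "\<exists>v A K B l r. splitting p W v A K B \<and> card A + l = a \<and> card B + r = b \<and>
    l \<le> M div 2 \<and> r \<le> M div 2"
proof (cases "a \<le> b")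
  case True
  then show ?thesis
    using balanced_splitting_aux[OF fin card] ab by blast
next
  case False
  have "card W = b + a + 1"
    using card by simp
  then have "\<exists>v A K B l r. splitting p W v A K B \<and> card A + l = b \<and> card B + r = a \<and>
      l \<le> M div 2 \<and> r \<le> M div 2"
    using balanced_splitting_aux[OF fin, of b a M p] False ab by simp
  then show ?thesis
    using splitting_swap by blast
qed

section \<open>Intervals and the positions around a cut\<close>

text \<open>This is the invariant of the recursion. All subintervals are included because the end
  parts of a splitting occupy intervals of unpredictable length and position.\<close>

definition intervals_full :: "nat set set \<Rightarrow> nat \<Rightarrow> nat \<Rightarrow> bool" where
  "intervals_full E lo hi \<longleftrightarrow> (\<forall>x y. lo \<le> x \<and> x \<le> y \<and> y \<le> hi \<longrightarrow> full E {x..<y})"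

lemma intervals_fullD:
  "intervals_full E lo hi \<Longrightarrow> lo \<le> x \<Longrightarrow> x \<le> y \<Longrightarrow> y \<le> hi \<Longrightarrow> full E {x..<y}"
  by (simp add: intervals_full_def)

text \<open>The positions available next to a cut \<open>q\<close> after \<open>q, \<dots>, q + j - 1\<close> have been used:
  \<open>a\<close> of them to the left and \<open>b\<close> to the right (including the next key \<open>q + j\<close>).\<close>

definition around :: "nat \<Rightarrow> nat \<Rightarrow> nat \<Rightarrow> nat \<Rightarrow> nat set" where
  "around q j a b = {q - a..<q} \<union> {q + j..<q + j + b}"

lemma card_around: "a \<le> q \<Longrightarrow> card (around q j a b) = a + b"
  unfolding around_def by (subst card_Un_disjoint) auto

text \<open>One key is used up: \<open>v\<close> goes to \<open>q + j\<close>, \<open>A\<close> and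
  \<open>B\<close> to the outer ends, which lie on one side of the cut each, and \<open>K\<close> to
  the innermost positions. The predicate \<open>P\<close> is whatever the chosen kind of splitting
  guarantees about the leftover sizes.\<close>

lemma full_around_step:
  assumes left: "intervals_full E lo q"
    and right: "intervals_full E q hi"
    and a: "lo + a \<le> q" and b: "q + j + b + 1 \<le> hi"
    and star: "\<And>y. y \<in> around q j a (b + 1) \<Longrightarrow> y \<noteq> q + j \<Longrightarrow> {q + j, y} \<in> E"
    and split: "\<And>p W. finite W \<Longrightarrow> card W = a + b + 1 \<Longrightarrow>
      \<exists>v A K B l r. splitting p W v A K B \<and> card A + l = a \<and> card B + r = b \<and> P l r"
    and rec: "\<And>l r. P l r \<Longrightarrow> l \<le> a \<Longrightarrow> r \<le> b \<Longrightarrow> full E (around q (Suc j) l r)"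
  shows "full E (around q j a (b + 1))"
  unfolding full_def
proof (intro allI impI, elim conjE)
  fix p W assume fin: "finite (W :: nat set)" and "card W = card (around q j a (b + 1))"
  then have card: "card W = a + b + 1"
    using a by (simp add: card_around)
  obtain v A K B l r where S: "splitting p W v A K B" and l: "card A + l = a"
    and r: "card B + r = b" and P: "P l r"
    using split[OF fin card] by blast
  have W: "W = insert v (A \<union> K \<union> B)" "v \<notin> A \<union> K \<union> B" "A \<inter> K = {}" "A \<inter> B = {}" "K \<inter> B = {}"
    using S by (auto simp: splitting_def)
  have finAKB: "finite A" "finite K" "finite B"
    using fin W(1) by auto
  have "card W = 1 + (card A + card K + card B)"
    using W finAKB by (simp add: card_Un_disjoint Int_Un_distrib2)
  then have K: "card K = l + r"
    using card l r by simp
  define XA XK XB where "XA = {q - a..<q - l}" and "XK = around q (Suc j) l r"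
    and "XB = {q + j + 1 + r..<q + j + 1 + b}"
  have "full E XA" "full E XB" "full E XK"
    unfolding XA_def XB_def XK_def using a b l r P by (intro intervals_fullD[OF left] intervals_fullD[OF right] rec; linarith)+
  moreover have "card A = card XA" "card B = card XB" "card K = card XK"
    using a l r K by (auto simp: XA_def XB_def XK_def card_around)
  ultimately obtain f g h where "embeds E p A f XA" "embeds E p K g XK" "embeds E p B h XB"
    unfolding full_def using finAKB by metis
  moreover have "{q - a..<q} = XA \<union> {q - l..<q}"
    "{q + j..<q + j + (b + 1)} = insert (q + j) ({q + Suc j..<q + Suc j + r} \<union> XB)"
    unfolding XA_def XB_def using l r a by auto
  then have "around q j a (b + 1) = insert (q + j) (XA \<union> XK \<union> XB)"
    unfolding around_def XK_def by blast
  moreover have "q + j \<notin> XA \<union> XK \<union> XB" "XA \<inter> XK = {}" "XA \<inter> XB = {}" "XK \<inter> XB = {}"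
    using l r a by (auto simp: around_def XA_def XK_def XB_def)
  ultimately show "\<exists>f. embeds E p W f (around q j a (b + 1))"
    using embeds_glue[OF S, of E _ XA _ XK _ XB "q + j"] star by (metis insertCI)
qed

text \<open>With one side empty, the set is a single interval on one side of the cut.\<close>

lemma full_around_trivial:
  assumes left: "intervals_full E lo q"
    and right: "intervals_full E q hi"
    and "lo + a \<le> q" "q + j + b \<le> hi" "a = 0 \<or> b = 0"
  shows "full E (around q j a b)"
  using assms(3-) intervals_fullD[OF left, of "q - a" q] intervals_fullD[OF right, of "q + j" "q + j + b"] by (auto simp: around_def)

section \<open>Fans of stars with halving radius\<close>

definition all_pairs :: "'a set \<Rightarrow> 'a set set" where
  "all_pairs X = {{u, v} | u v. u \<in> X \<and> v \<in> X \<and> u \<noteq> v}"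

definition star :: "'a \<Rightarrow> 'a set \<Rightarrow> 'a set set" where
  "star x Y = (\<lambda>y. {x, y}) ` Y"

text \<open>The keys \<open>q + j\<close>, \<open>q + j + 1\<close>, and so on have stars whose
  radius starts at \<open>M\<close> and is halved each time. The left arms end at \<open>q\<close>,
  since the positions between \<open>q\<close> and the key hold earlier keys. The range
  \<open>i \<le> M\<close> is generous: the radius is 0 once \<open>2 ^ i > M\<close>.\<close>

definition fan :: "nat \<Rightarrow> nat \<Rightarrow> nat \<Rightarrow> nat set set" where
  "fan q j M = (\<Union>i\<le>M. star (q + (j + i))
     ({q - M div 2 ^ i..<q} \<union> {q + (j + i) + 1..<q + (j + i) + 1 + M div 2 ^ i}))"

lemma all_pairsI: "u \<in> X \<Longrightarrow> v \<in> X \<Longrightarrow> u \<noteq> v \<Longrightarrow> {u, v} \<in> all_pairs X"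
  unfolding all_pairs_def by blast

text \<open>A fan may reach beyond \<open>hi\<close>, hence the intersection with
  \<open>all_pairs {0..<hi}\<close>. The assumption \<open>0 < a\<close> makes the radius positive,
  so \<open>i < 2 ^ i \<le> M\<close> is in the range of the fan.\<close>

lemma fan_edge:
  assumes "fan q j M \<inter> all_pairs {0..<hi} \<subseteq> E"
    and "a \<le> M div 2 ^ i" "b \<le> M div 2 ^ i" "0 < a" "q + (j + i) + b + 1 \<le> hi"
    and y: "y \<in> around q (j + i) a (b + 1)" "y \<noteq> q + (j + i)"
  shows "{q + (j + i), y} \<in> E"
proof -
  have "0 < M div 2 ^ i"
    using assms by linarith
  then have "2 ^ i \<le> M"
    by (simp add: div_greater_zero_iff)
  then have "i \<le> M"
    using less_exp[of i] by linarith
  moreover have "y \<in> {q - M div 2 ^ i..<q} \<union> {q + (j + i) + 1..<q + (j + i) + 1 + M div 2 ^ i}"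
    using assms unfolding around_def by auto
  ultimately have "{q + (j + i), y} \<in> fan q j M"
    unfolding fan_def star_def by blast
  moreover have "y < hi" "q + (j + i) < hi"
    using assms by (auto simp: around_def)
  then have "{q + (j + i), y} \<in> all_pairs {0..<hi}"
    using y(2) by (intro all_pairsI) auto
  ultimately show ?thesis
    using assms(1) by blast
qed

text \<open>Each balanced splitting halves the radius and passes to the next key. The bound on
  \<open>b\<close> is larger by one because \<open>b\<close> counts the key.\<close>

lemma full_around_halving:
  assumes left: "intervals_full E lo q"
    and right: "intervals_full E q hi"
    and fan: "fan q j M \<inter> all_pairs {0..<hi} \<subseteq> E"
    and "a \<le> M div 2 ^ i" "b \<le> M div 2 ^ i + 1" "lo + a \<le> q" "q + (j + i) + b \<le> hi"
  shows "full E (around q (j + i) a b)"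
  using assms(4-)
proof (induction "a + b" arbitrary: a b i rule: less_induct)
  case less
  show ?case
  proof (cases "a = 0 \<or> b = 0")
    case True
    show ?thesis
      by (rule full_around_trivial[OF left right]) (use less.prems True in auto)
  next
    case False
    then obtain c where c: "b = c + 1"
      by (metis Suc_eq_plus1 not0_implies_Suc)
    show ?thesis
      unfolding c
    proof (rule full_around_step[OF left right])
      show "\<exists>v A K B l r. splitting p W v A K B \<and> card A + l = a \<and> card B + r = c \<and>
          (l \<le> M div 2 ^ i div 2 \<and> r \<le> M div 2 ^ i div 2)"
        if "finite W" "card W = a + c + 1" for p W
        using balanced_splitting[OF that, of "M div 2 ^ i" p] less.prems c by simp
      show "full E (around q (Suc (j + i)) l r)"
        if "l \<le> M div 2 ^ i div 2 \<and> r \<le> M div 2 ^ i div 2" "l \<le> a" "r \<le> c" for l r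
        using less.hyps[of l r "Suc i"] that less.prems c
        by (simp add: div_mult2_eq[symmetric] mult.commute)
      show "{q + (j + i), y} \<in> E"
        if "y \<in> around q (j + i) a (c + 1)" "y \<noteq> q + (j + i)" for y
        using fan_edge[OF fan, of a i c y] that less.prems c False by simp
    qed (use less.prems c in auto)
  qed
qed

lemma all_pairs_subset: "all_pairs X \<subseteq> (\<lambda>(u, v). {u, v}) ` (X \<times> X)"
  by (auto simp: all_pairs_def)

lemma finite_all_pairs: "finite X \<Longrightarrow> finite (all_pairs X)"
  by (rule finite_subset[OF all_pairs_subset]) simp

lemma card_all_pairs_le:
  assumes "finite X"
  shows "card (all_pairs X) \<le> card X * card X"
  using assms card_mono[OF _ all_pairs_subset, of X] card_image_le[of "X \<times> X" "\<lambda>(u, v). {u, v}"]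
  by (auto simp: card_cartesian_product)

lemma card_star_le: "finite Y \<Longrightarrow> card (star x Y) \<le> card Y"
  by (simp add: star_def card_image_le)

lemma finite_fan: "finite (fan q j M)"
  by (auto simp: fan_def star_def)

lemma sum_div_power2_le: "(\<Sum>i\<le>N. M div 2 ^ i) \<le> 2 * (M :: nat)"
proof -
  have "real (\<Sum>i\<le>N. M div 2 ^ i) \<le> (\<Sum>i\<le>N. real M * (1 / 2) ^ i)"
    unfolding of_nat_sum
  proof (rule sum_mono)
    fix i
    show "real (M div 2 ^ i) \<le> real M * (1 / 2) ^ i"
      using of_nat_div_le_of_nat[of M "2 ^ i", where 'a = real] by (simp add: power_divide)
  qed
  also have "\<dots> = real M * (\<Sum>i\<le>N. (1 / 2) ^ i)"
    by (simp add: sum_distrib_left)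
  also have "(\<Sum>i\<le>N. (1 / 2 :: real) ^ i) = 2 - (1 / 2) ^ N"
    by (induction N) auto
  also have "real M * \<dots> \<le> real M * 2"
    by (intro mult_left_mono) auto
  finally have "real (\<Sum>i\<le>N. M div 2 ^ i) \<le> real (2 * M)"
    by simp
  then show ?thesis
    by (simp only: of_nat_le_iff)
qed

text \<open>Each star has two arms, and the radii add up to at most \<open>2 * M\<close>.\<close>

lemma card_fan_le: "card (fan q j M) \<le> 4 * M"
proof -
  have "card (fan q j M) \<le> (\<Sum>i\<le>M. card (star (q + (j + i))
     ({q - M div 2 ^ i..<q} \<union> {q + (j + i) + 1..<q + (j + i) + 1 + M div 2 ^ i})))"
    unfolding fan_def by (rule card_UN_le) simp
  also have "\<dots> \<le> (\<Sum>i\<le>M. 2 * (M div 2 ^ i))"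
  proof (rule sum_mono)
    fix i
    let ?Y = "{q - M div 2 ^ i..<q} \<union> {q + (j + i) + 1..<q + (j + i) + 1 + M div 2 ^ i}"
    have "card (star (q + (j + i)) ?Y) \<le> card ?Y"
      by (rule card_star_le) simp
    also have "\<dots> \<le> 2 * (M div 2 ^ i)"
      by (rule order_trans[OF card_Un_le]) simp
    finally show "card (star (q + (j + i)) ?Y) \<le> 2 * (M div 2 ^ i)" .
  qed
  also have "\<dots> \<le> 4 * M"
    using sum_div_power2_le[of M M] by (simp add: sum_distrib_left[symmetric])
  finally show ?thesis .
qed

section \<open>Joining two adjacent blocks at a cut\<close>

lemma intervals_fullI_cut:
  assumes left: "intervals_full E lo q" and right: "intervals_full E q hi"
    and cut: "\<And>a b. 0 < a \<Longrightarrow> 0 < b \<Longrightarrow> lo + a \<le> q \<Longrightarrow> q + b \<le> hi \<Longrightarrow> full E (around q 0 a b)"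
  shows "intervals_full E lo hi"
  unfolding intervals_full_def
proof (intro allI impI)
  fix x y assume xy: "lo \<le> x \<and> x \<le> y \<and> y \<le> hi"
  consider "y \<le> q" | "q \<le> x" | "x < q" "q < y"
    by linarith
  then show "full E {x..<y}"
  proof cases
    case 3
    then have "{x..<y} = around q 0 (q - x) (y - q)"
      by (auto simp: around_def)
    then show ?thesis
      using cut[of "q - x" "y - q"] 3 xy by force
  qed (use xy intervals_fullD[OF left] intervals_fullD[OF right] in auto)
qed

lemma intervals_full_even_cut:
  assumes left: "intervals_full E lo q" and right: "intervals_full E q hi"
    and fan: "fan q 0 M \<inter> all_pairs {0..<hi} \<subseteq> E" and "q \<le> lo + M" "hi \<le> q + M"
  shows "intervals_full E lo hi"
proof (rule intervals_fullI_cut[OF left right])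
  fix a b assume "0 < a" "0 < b" "lo + a \<le> q" "q + b \<le> hi"
  then show "full E (around q 0 a b)"
    using full_around_halving[OF left right fan, of a 0 b] assms(4,5) by simp
qed

text \<open>The left side has length \<open>m\<close>, while the right side may be longer, so the
  first key is joined to everything. Two keys suffice to bring both leftovers down to
  \<open>m div 4\<close>, where a fan takes over.\<close>

lemma intervals_full_uneven_cut:
  assumes left: "intervals_full E 0 m" and right: "intervals_full E m hi"
    and star0: "star m ({0..<hi} - {m}) \<subseteq> E"
    and star1: "star (m + 1) ({m - m div 2..<m} \<union> {m + 2..<m + 2 + m}) \<inter> all_pairs {0..<hi} \<subseteq> E"
    and fan: "fan m 2 (m div 4) \<inter> all_pairs {0..<hi} \<subseteq> E"
  shows "intervals_full E 0 hi"
proof (rule intervals_fullI_cut[OF left right])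
  have two: "full E (around m 2 a b)" if "a \<le> m div 4" "b \<le> m div 4" "m + 2 + b \<le> hi" for a b
    using full_around_halving[OF left right fan, of a 0 b] that by simp
  \<comment> \<open>The disjunction is what the first key guarantees: the right leftover may be as
    large as \<open>m\<close>, but only if the left one is small.\<close>
  have one: "full E (around m 1 a b)"
    if ab: "a \<le> m div 2" "b \<le> m" "a \<le> m div 4 \<or> b \<le> m div 2" "m + 1 + b \<le> hi" for a b
  proof (cases "a = 0 \<or> b = 0")
    case True
    show ?thesis
      by (rule full_around_trivial[OF left right]) (use True ab in auto)
  next
    case False
    then obtain c where c: "b = c + 1"
      by (metis Suc_eq_plus1 not0_implies_Suc)
    show ?thesis
      unfolding c
    proof (rule full_around_step[OF left right])
      show "{m + 1, y} \<in> E" if y: "y \<in> around m 1 a (c + 1)" "y \<noteq> m + 1" for y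
      proof -
        have "y \<in> {m - m div 2..<m} \<union> {m + 2..<m + 2 + m}"
          using y ab c by (auto simp: around_def)
        moreover have "y < hi" "m + 1 < hi"
          using y ab c by (auto simp: around_def)
        then have "{m + 1, y} \<in> all_pairs {0..<hi}"
          using y(2) by (intro all_pairsI) auto
        ultimately show ?thesis
          using star1 unfolding star_def by blast
      qed
      show "\<exists>v A K B l r. splitting p W v A K B \<and> card A + l = a \<and> card B + r = c \<and>
          (l \<le> m div 4 \<and> r \<le> m div 4)"
        if W: "finite W" "card W = a + c + 1" for p W
      \<comment> \<open>If both sides are at most \<open>m div 2\<close>, a balanced splitting
        halves them. Otherwise \<open>a \<le> m div 4\<close>, and \<open>2 * l + r \<le> a\<close>
        bounds both leftovers at once.\<close>
      proof (cases "b \<le> m div 2")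
        case True
        then have "\<exists>v A K B l r. splitting p W v A K B \<and> card A + l = a \<and> card B + r = c \<and>
            l \<le> m div 2 div 2 \<and> r \<le> m div 2 div 2"
          using ab c by (intro balanced_splitting[OF W]) auto
        then show ?thesis
          by (simp add: div_mult2_eq[symmetric])
      next
        case False
        then have "a \<le> m div 4"
          using ab by blast
        obtain v A K B l r where S: "splitting p W v A K B" "card A + l = a" "card B + r = c"
          and "2 * l + r \<le> a"
          by (rule unbalanced_splitting[OF W, where p = p])
        with \<open>a \<le> m div 4\<close> have "l \<le> m div 4 \<and> r \<le> m div 4"
          by linarith
        with S show ?thesis
          by blast
      qed
      show "full E (around m (Suc 1) l r)"
        if "l \<le> m div 4 \<and> r \<le> m div 4" "l \<le> a" "r \<le> c" for l r
        using two[of l r] that ab c by (simp add: numeral_2_eq_2)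
    qed (use ab c in auto)
  qed
  fix a b assume ab: "0 < a" "0 < b" "0 + a \<le> m" "m + b \<le> hi"
  then obtain c where c: "b = c + 1"
    by (metis Suc_eq_plus1 gr0_implies_Suc)
  show "full E (around m 0 a b)"
    unfolding c
  proof (rule full_around_step[OF left right])
    show "{m + 0, y} \<in> E" if y: "y \<in> around m 0 a (c + 1)" "y \<noteq> m + 0" for y
    proof -
      have "y \<in> {0..<hi} - {m}"
        using y ab c by (auto simp: around_def)
      then show ?thesis
        using star0 unfolding star_def by auto
    qed
    show "\<exists>v A K B l r. splitting p W v A K B \<and> card A + l = a \<and> card B + r = c \<and>
        (l \<le> m div 2 \<and> r \<le> m \<and> (l \<le> m div 4 \<or> r \<le> m div 2))"
      if W: "finite W" "card W = a + c + 1" for p W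
    proof (cases "c \<le> m")
      case True
      have "\<exists>v A K B l r. splitting p W v A K B \<and> card A + l = a \<and> card B + r = c \<and>
          l \<le> m div 2 \<and> r \<le> m div 2"
        using ab True by (intro balanced_splitting[OF W]) auto
      then obtain v A K B l r where "splitting p W v A K B" "card A + l = a"
        "card B + r = c" "l \<le> m div 2" "r \<le> m div 2"
        by blast
      moreover from this have "r \<le> m"
        by linarith
      ultimately show ?thesis
        by blast
    next
      case False
      obtain v A K B l r where S: "splitting p W v A K B" "card A + l = a" "card B + r = c"
        and "2 * l + r \<le> a"
        by (rule unbalanced_splitting[OF W, where p = p])
      \<comment> \<open>From \<open>2 * l + r \<le> m\<close>, a value \<open>l > m div 4\<close>
        forces \<open>r \<le> m div 2\<close>.\<close>
      with ab have "l \<le> m div 2 \<and> r \<le> m \<and> (l \<le> m div 4 \<or> r \<le> m div 2)"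
        by linarith
      with S show ?thesis
        by blast
    qed
    show "full E (around m (Suc 0) l r)"
      if "l \<le> m div 2 \<and> r \<le> m \<and> (l \<le> m div 4 \<or> r \<le> m div 2)" "l \<le> a" "r \<le> c" for l r
      using one[of l r] that ab c by simp
  qed (use ab c in auto)
qed

section \<open>Monotonicity, translation and complete graphs\<close>

lemma full_mono: "full E X \<Longrightarrow> E \<subseteq> E' \<Longrightarrow> full E' X"
  unfolding full_def embeds_def by (meson subsetD)

lemma intervals_full_mono: "intervals_full E lo hi \<Longrightarrow> E \<subseteq> E' \<Longrightarrow> intervals_full E' lo hi"
  unfolding intervals_full_def by (meson full_mono)

lemma full_shift:
  assumes "full E X"
  shows "full ((`) ((+) s) ` E) ((+) s ` X)"
  unfolding full_def
proof (intro allI impI, elim conjE)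
  fix p W assume "finite (W :: nat set)" "card W = card ((+) s ` X)"
  then obtain f where f: "embeds E p W f X"
    using assms by (auto simp: full_def card_image)
  have "bij_betw ((+) s) X ((+) s ` X)"
    by (simp add: bij_betw_def)
  then have "bij_betw ((+) s \<circ> f) W ((+) s ` X)"
    using f unfolding embeds_def by (blast intro: bij_betw_trans)
  moreover have "{s + f u, s + f (p u)} \<in> (`) ((+) s) ` E" if "{f u, f (p u)} \<in> E" for u
    using imageI[OF that, of "(`) ((+) s)"] by simp
  ultimately show "\<exists>f. embeds ((`) ((+) s) ` E) p W f ((+) s ` X)"
    using f unfolding embeds_def by (intro exI[of _ "(+) s \<circ> f"]) auto
qed

lemma intervals_full_shift:
  assumes "intervals_full E 0 k"
  shows "intervals_full ((`) ((+) s) ` E) s (s + k)"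
  unfolding intervals_full_def
proof (intro allI impI)
  fix x y assume xy: "s \<le> x \<and> x \<le> y \<and> y \<le> s + k"
  then have "{x..<y} = (+) s ` {x - s..<y - s}"
    by (simp add: image_add_atLeastLessThan)
  then show "full ((`) ((+) s) ` E) {x..<y}"
    using full_shift[OF intervals_fullD[OF assms, of "x - s" "y - s"], of s] xy
    by (simp only:) linarith
qed

lemma all_pairs_shift:
  fixes s k n :: nat
  assumes "E \<subseteq> all_pairs {0..<k}" "s + k \<le> n"
  shows "(`) ((+) s) ` E \<subseteq> all_pairs {0..<n}"
proof
  fix e assume "e \<in> (`) ((+) s) ` E"
  then obtain e' where e': "e' \<in> E" "e = (+) s ` e'"
    by (rule imageE)
  then obtain u v where "e' = {u, v}" "u < k" "v < k" "u \<noteq> v"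
    using subsetD[OF assms(1) e'(1)] by (auto simp: all_pairs_def)
  then have "e = {s + u, s + v}" "s + u < n" "s + v < n" "s + u \<noteq> s + v"
    using e' assms(2) by auto
  then show "e \<in> all_pairs {0..<n}"
    by (simp add: all_pairsI)
qed

lemma intervals_full_all_pairs: "intervals_full (all_pairs {0..<n}) 0 n"
  unfolding intervals_full_def full_def
proof (intro allI impI, elim conjE)
  fix x y and p :: "nat \<Rightarrow> nat" and W :: "nat set"
  assume "y \<le> n" "finite W" "card W = card {x..<y}"
  then obtain f where f: "bij_betw f W {x..<y}"
    by (metis finite_atLeastLessThan finite_same_card_bij)
  have "{f u, f (p u)} \<in> all_pairs {0..<n}" if "u \<in> W" "p u \<in> W" "p u < u" for u
  proof -
    have "f u \<noteq> f (p u)"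
      using that inj_onD[OF bij_betw_imp_inj_on[OF f], of u "p u"] by auto
    moreover have "f u < n" "f (p u) < n"
      using that bij_betwE[OF f] \<open>y \<le> n\<close> by force+
    ultimately show ?thesis
      by (intro all_pairsI) auto
  qed
  then show "\<exists>f. embeds (all_pairs {0..<n}) p W f {x..<y}"
    using f unfolding embeds_def by blast
qed

section \<open>The recurrence and the construction in thirds\<close>

text \<open>All parts are at most \<open>(n + 2) / 3\<close>, so each logarithm is at most
  \<open>log 3 n - 1 + log 3 (1 + 2 / n)\<close>. The last term is at most \<open>2 / n\<close>, as
  \<open>ln 3 \<ge> 1\<close>, and contributes the 2 after multiplication by
  \<open>n\<close>.\<close>

lemma log3_recurrence:
  fixes n1 n2 n3 :: nat
  assumes "0 < n1" "0 < n2" "0 < n3" "3 * n1 \<le> n1 + n2 + n3 + 2" "n2 \<le> n1" "n3 \<le> n1"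
  defines "n \<equiv> n1 + n2 + n3"
  shows "real n1 * log 3 n1 + real n2 * log 3 n2 + real n3 * log 3 n3 \<le> real n * log 3 n + 2 - real n"
proof -
  have "1 \<le> ln (3 :: real)"
    using exp_le by (simp add: ln_ge_iff)
  have n: "0 < n"
    using assms by simp
  define L where "L = log 3 ((real n + 2) / 3)"
  have "log 3 (real k) \<le> L" if "0 < k" "k \<le> n1" for k
    unfolding L_def using that assms(4) by (subst log_le_cancel_iff) (auto simp: n_def)
  then have "real n1 * log 3 n1 + real n2 * log 3 n2 + real n3 * log 3 n3
      \<le> real n1 * L + real n2 * L + real n3 * L"
    using assms by (intro add_mono mult_left_mono) auto
  also have "\<dots> = real n * L"
    by (simp add: n_def algebra_simps)
  also have "L = log 3 (real n * (1 + 2 / real n)) - 1"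
  proof -
    have "real n + 2 = real n * (1 + 2 / real n)"
      using n by (simp add: field_simps)
    then show ?thesis
      unfolding L_def by (subst log_divide) auto
  qed
  also have "\<dots> = log 3 n + log 3 (1 + 2 / real n) - 1"
  proof -
    have "1 + 2 / real n \<noteq> 0"
      using n by (simp add: add_nonneg_eq_0_iff)
    then show ?thesis
      using n by (simp add: log_mult)
  qed
  also have "log 3 (1 + 2 / real n) \<le> ln (1 + 2 / real n) / 1"
    unfolding log_def using \<open>1 \<le> ln 3\<close> n by (intro divide_left_mono) auto
  also have "\<dots> \<le> 2 / real n"
    using ln_add_one_self_le_self[of "2 / real n"] by simp
  finally have "real n1 * log 3 n1 + real n2 * log 3 n2 + real n3 * log 3 n3
      \<le> real n * (log 3 n + 2 / real n - 1)"
    using n by (simp add: mult_left_mono)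
  also have "\<dots> = real n * log 3 n + 2 - real n"
    using n by (simp add: field_simps)
  finally show ?thesis .
qed

lemma card_image_Un3_le:
  assumes "finite A" "finite B" "finite C" 
  shows "card (A \<union> f ` B \<union> g ` C) \<le> card A + card B + card C"
  using card_Un_le[of "A \<union> f ` B" "g ` C"] card_Un_le[of A "f ` B"]
    card_image_le[OF assms(2), of f] card_image_le[OF assms(3), of g] by linarith

text \<open>The term \<open>- 7\<close> absorbs the rounding of \<open>n / 3\<close> in the induction.\<close>

lemma interval_universal_graph:
  assumes "0 < n"
  shows "\<exists>E. E \<subseteq> all_pairs {0..<n} \<and> intervals_full E 0 n \<and>
    real (card E) \<le> 19 / 6 * (real n * log 3 n) + 23 * real n - 7"
  using assms
proof (induction n rule: less_induct)
  case (less n)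
  show ?case
  \<comment> \<open>For \<open>n = 4\<close> the last block below would be empty; from 5 on it is
    not. Small \<open>n\<close> take the complete graph, with at most \<open>16 \<le> 23 - 7\<close>
    edges.\<close>
  proof (cases "n \<le> 4")
    case True
    have "card (all_pairs {0..<n}) \<le> n * n"
      using card_all_pairs_le[of "{0..<n}"] by simp
    also have "\<dots> \<le> 4 * 4"
      using True by (intro mult_le_mono)
    finally have "real (card (all_pairs {0..<n})) \<le> 16"
      by simp
    moreover have "0 \<le> real n * log 3 n" "1 \<le> real n"
      using less.prems by auto
    ultimately have "real (card (all_pairs {0..<n})) \<le> 19 / 6 * (real n * log 3 n) + 23 * real n - 7"
      by argo
    then show ?thesis
      using intervals_full_all_pairs[of n] by blast
  next
    case False
    define m where "m = (n + 2) div 3"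
    have m: "0 < m" "m < n" "2 * m < n" "n \<le> 3 * m" "3 * m \<le> n + 2"
      using False unfolding m_def by linarith+
    define k where "k = n - 2 * m"
    have k: "0 < k" "k \<le> m" "k < n" "n = m + m + k"
      using m by (auto simp: k_def)
    obtain E1 where E1: "E1 \<subseteq> all_pairs {0..<m}" "intervals_full E1 0 m"
      and card1: "real (card E1) \<le> 19 / 6 * (real m * log 3 m) + 23 * real m - 7"
      using less.IH[of m] m by blast
    obtain E3 where E3: "E3 \<subseteq> all_pairs {0..<k}" "intervals_full E3 0 k"
      and card3: "real (card E3) \<le> 19 / 6 * (real k * log 3 k) + 23 * real k - 7"
      using less.IH[of k] k by blast
    define R where "R = E1 \<union> (`) ((+) m) ` E1 \<union> (`) ((+) (2 * m)) ` E3"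
    define S0 where "S0 = star m ({0..<n} - {m})"
    define S1 where "S1 = star (m + 1) ({m - m div 2..<m} \<union> {m + 2..<m + 2 + m})"
    define F1 where "F1 = fan m 2 (m div 4)"
    define F2 where "F2 = fan (2 * m) 0 m"
    \<comment> \<open>\<open>R\<close> holds the blocks of lengths \<open>m\<close>,
      \<open>m\<close>, \<open>k\<close>; \<open>S0\<close>, \<open>S1\<close>, \<open>F1\<close>
      serve the cut at \<open>m\<close>, and \<open>F2\<close> the cut at
      \<open>2 * m\<close>.\<close>
    define E where "E = R \<union> (S0 \<union> S1 \<union> F1 \<union> F2) \<inter> all_pairs {0..<n}"
    have "(`) ((+) 0) ` E1 \<subseteq> all_pairs {0..<n}"
      by (rule all_pairs_shift[OF E1(1)]) (use m in simp)
    moreover have "(`) ((+) m) ` E1 \<subseteq> all_pairs {0..<n}"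
      by (rule all_pairs_shift[OF E1(1)]) (use m in simp)
    moreover have "(`) ((+) (2 * m)) ` E3 \<subseteq> all_pairs {0..<n}"
      by (rule all_pairs_shift[OF E3(1)]) (use k in simp)
    ultimately have E_sub: "E \<subseteq> all_pairs {0..<n}"
      by (auto simp: E_def R_def)
    have S0_sub: "S0 \<subseteq> all_pairs {0..<n}"
      unfolding S0_def star_def using m by (auto intro!: all_pairsI)
    have "intervals_full E 0 m"
      by (rule intervals_full_mono[OF E1(2)]) (auto simp: E_def R_def)
    \<comment> \<open>The cut at \<open>2 * m\<close> comes first, with sides \<open>m\<close> and
      \<open>k \<le> m\<close>; this leaves sides \<open>m\<close> and \<open>m + k\<close> for the
      uneven cut.\<close>
    moreover have "intervals_full E m n"
    proof (rule intervals_full_even_cut[of E m "2 * m" n m])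
      show "intervals_full E m (2 * m)"
        using intervals_full_mono[OF intervals_full_shift[OF E1(2), of m], of E]
        by (auto simp: E_def R_def mult_2)
      show "intervals_full E (2 * m) n"
        using intervals_full_mono[OF intervals_full_shift[OF E3(2), of "2 * m"], of E] k
        by (auto simp: E_def R_def mult_2)
    qed (use k in \<open>auto simp: E_def F2_def\<close>)
    ultimately have "intervals_full E 0 n"
      by (rule intervals_full_uneven_cut) (use S0_sub in \<open>auto simp: E_def S0_def S1_def F1_def\<close>)
    moreover have "real (card E) \<le> 19 / 6 * (real n * log 3 n) + 23 * real n - 7"
    proof -
      have fin: "finite E1" "finite E3"
        using E1(1) E3(1) by (meson finite_all_pairs finite_atLeastLessThan finite_subset)+
      then have R: "card R \<le> card E1 + card E1 + card E3"
        unfolding R_def by (intro card_image_Un3_le)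
      have S0: "card S0 \<le> n"
        unfolding S0_def by (rule order_trans[OF card_star_le]) (use m in auto)
      have "card ({m - m div 2..<m} \<union> {m + 2..<m + 2 + m}) \<le> m div 2 + m"
        by (rule order_trans[OF card_Un_le]) simp
      then have "card S1 \<le> m div 2 + m"
        unfolding S1_def by (rule order_trans[OF card_star_le, rotated]) simp
      then have S1: "2 * card S1 \<le> 3 * m"
        by linarith
      have "card F1 \<le> 4 * (m div 4)"
        unfolding F1_def by (rule card_fan_le)
      then have F: "card F1 \<le> m" "card F2 \<le> 4 * m"
        unfolding F2_def using card_fan_le[of "2 * m" 0 m] by linarith+
      have "finite (S0 \<union> S1 \<union> F1 \<union> F2)"
        by (auto simp: S0_def S1_def F1_def F2_def star_def finite_fan)
      then have "card ((S0 \<union> S1 \<union> F1 \<union> F2) \<inter> all_pairs {0..<n}) \<le> card (S0 \<union> S1 \<union> F1 \<union> F2)"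
        by (intro card_mono) auto
      also have "\<dots> \<le> card S0 + card S1 + card F1 + card F2"
        by (intro order_trans[OF card_Un_le] add_mono order_refl)
      finally have "card E \<le> card R + (card S0 + card S1 + card F1 + card F2)"
        using card_Un_le[of R "(S0 \<union> S1 \<union> F1 \<union> F2) \<inter> all_pairs {0..<n}", folded E_def]
        by linarith
      \<comment> \<open>The keys cost at most \<open>3 m + 3 m / 2 + m + 4 m = 19 m / 2\<close>;
        doubling keeps the count in the integers.\<close>
      then have "2 * card E \<le> 2 * (card E1 + card E1 + card E3) + 19 * m"
        using R S0 S1 F \<open>n \<le> 3 * m\<close> by presburger
      then have "real (2 * card E) \<le> real (2 * (card E1 + card E1 + card E3) + 19 * m)"
        by (rule of_nat_mono)
      then have "2 * real (card E) \<le> 2 * (real (card E1) + real (card E1) + real (card E3)) + 19 * real m"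
        by simp
      moreover have "3 * real m \<le> real n + 2"
        using m by linarith
      ultimately have "real (card E) \<le> real (card E1) + real (card E1) + real (card E3) + 19 / 6 * (real n + 2)"
        by argo
      also have "\<dots> \<le> (19 / 6 * (real m * log 3 m + real m * log 3 m + real k * log 3 k)
          + 23 * (real m + real m + real k) - 21) + 19 / 6 * (real n + 2)"
        using card1 card3 by (simp add: field_simps)
      also have "\<dots> \<le> (19 / 6 * (real n * log 3 n + 2 - real n) + 23 * real n - 21) + 19 / 6 * (real n + 2)"
        using log3_recurrence[of m m k] m k by simp
      \<comment> \<open>Rounding adds \<open>4 * 19 / 6 = 38 / 3\<close>, less than the 14 gained
        from three terms \<open>- 7\<close> against one.\<close>
      also have "\<dots> \<le> 19 / 6 * (real n * log 3 n) + 23 * real n - 7"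
        by (simp add: field_simps)
      finally show ?thesis .
    qed
    ultimately show ?thesis
      using E_sub by blast
  qed
qed

section \<open>From acyclic graphs to parent functions\<close>

lemma simple_graph_edgeD:
  assumes "simple_graph G" "{u, v} \<in> edges G"
  shows "u \<in> verts G" "v \<in> verts G" "u \<noteq> v"
proof -
  obtain a b where "{u, v} = {a, b}" "a \<in> verts G" "b \<in> verts G" "a \<noteq> b"
    using assms unfolding simple_graph_def by blast
  then show "u \<in> verts G" "v \<in> verts G" "u \<noteq> v"
    by (auto simp: doubleton_eq_iff)
qed

text \<open>The first vertex of a longest path is a leaf: its neighbours lie on the path, and one
  beyond the second vertex would close a cycle.\<close>

lemma acyclic_graph_leaf:
  assumes G: "simple_graph G" and acyclic: "\<not> (\<exists>p. cycle G p)" and ne: "verts G \<noteq> {}"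
  obtains x where "x \<in> verts G" "\<And>y z. {x, y} \<in> edges G \<Longrightarrow> {x, z} \<in> edges G \<Longrightarrow> y = z"
proof -
  define path where "path p \<longleftrightarrow> walk G p \<and> distinct p" for p
  obtain v where "v \<in> verts G"
    using ne by blast
  then have "path [v]"
    by (simp add: path_def walk_def)
  moreover have "length p < Suc (card (verts G))" if "path p" for p
    using that G card_mono[of "verts G" "set p"]
    by (auto simp: path_def walk_def simple_graph_def distinct_card)
  ultimately obtain p where p: "path p" and longest: "\<And>q. path q \<Longrightarrow> length q \<le> length p"
    using ex_has_greatest_nat[of path "[v]" length "Suc (card (verts G))"] by blast
  have p_ne: "p \<noteq> []" and p_sub: "set p \<subseteq> verts G" and p_dist: "distinct p"
    and p_succ: "successively (\<lambda>u v. {u, v} \<in> edges G) p"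
    using p by (auto simp: path_def walk_def)
  have nb: "1 < length p \<and> y = p ! 1" if y: "{hd p, y} \<in> edges G" for y
  proof -
    have "y \<in> set p"
    proof (rule ccontr)
      assume "y \<notin> set p"
      then have "path (y # p)"
        using p p_ne y simple_graph_edgeD[OF G y]
        by (auto simp: path_def walk_def successively_Cons insert_commute)
      then show False
        using longest by force
    qed
    then obtain k where k: "k < length p" "p ! k = y"
      by (auto simp: in_set_conv_nth)
    have "k \<noteq> 0"
      using k p_ne simple_graph_edgeD(3)[OF G y] by (metis hd_conv_nth)
    moreover have "\<not> 2 \<le> k"
    proof
      assume "2 \<le> k"
      let ?c = "take (Suc k) p"
      have "successively (\<lambda>u v. {u, v} \<in> edges G) ?c"
        using p_succ by (metis append_take_drop_id successively_append_iff)
      moreover have "last ?c = y" "hd ?c = hd p"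
        using k p_ne by (auto simp: take_Suc_conv_app_nth hd_append hd_conv_nth)
      ultimately have "cycle G ?c"
        using k p_ne p_sub p_dist y \<open>2 \<le> k\<close>
        by (auto simp: cycle_def walk_def insert_commute dest: in_set_takeD)
      then show False
        using acyclic by blast
    qed
    ultimately have "k = 1"
      by linarith
    then show ?thesis
      using k by auto
  qed
  show ?thesis
  proof (rule that)
    show "hd p \<in> verts G"
      using p_ne p_sub by auto
    show "y = z" if "{hd p, y} \<in> edges G" "{hd p, z} \<in> edges G" for y z
      using nb[OF that(1)] nb[OF that(2)] by simp
  qed
qed

text \<open>A leaf is removed and the rest numbered by induction. The leaf then gets the largest
  number, and its only possible neighbour becomes its parent.\<close>

lemma acyclic_graph_parents:
  fixes G :: "'a graph"
  assumes "simple_graph G" "\<not> (\<exists>p. cycle G p)"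
  shows "\<exists>g p. bij_betw g (verts G) {..<card (verts G)} \<and>
    (\<forall>u v. {u, v} \<in> edges G \<longrightarrow> p (g u) = g v \<and> g v < g u \<or> p (g v) = g u \<and> g u < g v)"
  using assms
proof (induction "card (verts G)" arbitrary: G)
  case 0
  then have "verts G = {}"
    by (simp add: simple_graph_def)
  moreover from this have "{u, v} \<notin> edges G" for u v
    using simple_graph_edgeD[OF "0.prems"(1)] by blast
  ultimately show ?case
    by (auto simp: bij_betw_def)
next
  case (Suc n)
  then have "verts G \<noteq> {}" and fin: "finite (verts G)"
    by (auto simp: simple_graph_def)
  then obtain x where x: "x \<in> verts G"
    and leaf: "\<And>y z. {x, y} \<in> edges G \<Longrightarrow> {x, z} \<in> edges G \<Longrightarrow> y = z"
    using acyclic_graph_leaf[OF Suc.prems] by metis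
  define G' where "G' = (verts G - {x}, {e \<in> edges G. x \<notin> e})"
  have card': "n = card (verts G')"
    using Suc.hyps(2) x fin by (simp add: G'_def)
  have edge': "{u, v} \<in> edges G' \<longleftrightarrow> {u, v} \<in> edges G \<and> u \<noteq> x \<and> v \<noteq> x" for u v
    by (auto simp: G'_def)
  have "simple_graph G'"
    unfolding simple_graph_def
  proof (intro conjI subsetI)
    show "finite (verts G')"
      using fin by (simp add: G'_def)
    fix e assume e: "e \<in> edges G'"
    then have "e \<in> edges G" "x \<notin> e"
      by (auto simp: G'_def)
    then obtain u v where "e = {u, v}" "u \<in> verts G" "v \<in> verts G" "u \<noteq> v"
      using Suc.prems(1) unfolding simple_graph_def by blast
    then show "e \<in> {{u, v} | u v. u \<in> verts G' \<and> v \<in> verts G' \<and> u \<noteq> v}"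
      using \<open>x \<notin> e\<close> by (auto simp: G'_def)
  qed
  moreover have "cycle G q" if "cycle G' q" for q
    using that by (auto simp: cycle_def walk_def G'_def intro: successively_mono)
  then have "\<not> (\<exists>q. cycle G' q)"
    using Suc.prems(2) by blast
  ultimately obtain g p where g: "bij_betw g (verts G') {..<n}"
    and p: "\<And>u v. {u, v} \<in> edges G' \<Longrightarrow> p (g u) = g v \<and> g v < g u \<or> p (g v) = g u \<and> g u < g v"
    using Suc.hyps(1)[OF card'] card' by metis
  \<comment> \<open>If \<open>x\<close> is isolated, \<open>y\<close> is arbitrary; the pair that
    \<open>p'\<close> then encodes is no edge of \<open>G\<close> and does no harm.\<close>
  obtain y where y: "\<And>z. {x, z} \<in> edges G \<Longrightarrow> z = y"
    using leaf by blast
  define h where "h = g(x := n)"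
  have "bij_betw h (verts G' \<union> {x}) ({..<n} \<union> {n})"
  proof (rule bij_betw_combine)
    show "bij_betw h (verts G') {..<n}"
      using g by (subst bij_betw_cong[of _ _ g]) (auto simp: h_def G'_def)
  qed (auto simp: h_def)
  moreover have "verts G' \<union> {x} = verts G" "{..<n} \<union> {n} = {..<card (verts G)}"
    using x Suc.hyps(2)[symmetric] by (auto simp: G'_def)
  ultimately have h: "bij_betw h (verts G) {..<card (verts G)}"
    by simp
  have g_less: "g u < n" if "u \<in> verts G" "u \<noteq> x" for u
    using bij_betwE[OF g] that by (auto simp: G'_def)
  define p' where "p' = p(n := g y)"
  have "p' (h u) = h v \<and> h v < h u \<or> p' (h v) = h u \<and> h u < h v" if uv: "{u, v} \<in> edges G" for u v
  proof -
    have V: "u \<in> verts G" "v \<in> verts G" "u \<noteq> v"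
      using simple_graph_edgeD[OF Suc.prems(1) uv] .
    consider "u = x" | "v = x" | "u \<noteq> x" "v \<noteq> x"
      by blast
    then show ?thesis
    proof cases
      case 1
      then show ?thesis
        using y uv V g_less[of v] by (auto simp: h_def p'_def)
    next
      case 2
      then have "u = y"
        using y uv by (metis insert_commute)
      with 2 show ?thesis
        using V g_less[of u] by (auto simp: h_def p'_def)
    next
      case 3
      then show ?thesis
        using p[of u v] uv V g_less[of u] g_less[of v] by (auto simp: h_def p'_def edge')
    qed
  qed
  with h show ?case
    by blast
qed

lemma isomorphic_image:
  assumes G: "simple_graph G" and inj: "inj_on f (verts G)"
  shows "isomorphic G (f ` verts G, (`) f ` edges G)"
  unfolding isomorphic_def
proof (intro exI[of _ f] conjI ballI)
  show "bij_betw f (verts G) (verts (f ` verts G, (`) f ` edges G))"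
    using inj by (simp add: bij_betw_def)
  fix u v assume uv: "u \<in> verts G" "v \<in> verts G"
  have "{u, v} \<in> edges G" if "f ` e = f ` {u, v}" "e \<in> edges G" for e
  proof -
    have "e \<subseteq> verts G"
      using G that(2) unfolding simple_graph_def by blast
    then have "e = {u, v}"
      using inj_on_image_eq_iff[OF inj, of e "{u, v}"] uv that(1) by simp
    then show ?thesis
      using that(2) by simp
  qed
  moreover have "f ` {u, v} = {f u, f v}"
    by simp
  ultimately show "{u, v} \<in> edges G \<longleftrightarrow> {f u, f v} \<in> edges (f ` verts G, (`) f ` edges G)"
    using imageI[of "{u, v}" "edges G" "(`) f"] by auto
qed

section \<open>Universality and the asymptotic bound\<close>

text \<open>After numbering the vertices of a tree by \<open>g\<close>, each edge joins a vertex to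
  its parent under \<open>p\<close>, so an embedding of the forest encoded by \<open>p\<close> maps
  every tree edge into \<open>E\<close>.\<close>

lemma universal_if_full:
  assumes E: "E \<subseteq> all_pairs {0..<n}" and full: "full E {0..<n}"
  shows "universal ({0..<n}, E) (trees n)"
  unfolding universal_def
proof
  fix T assume "T \<in> trees n"
  then have T: "simple_graph T" "\<not> (\<exists>p. cycle T p)" and card: "card (verts T) = n"
    by (auto simp: trees_def tree_def)
  obtain g p where g: "bij_betw g (verts T) {..<n}"
    and p: "\<And>u v. {u, v} \<in> edges T \<Longrightarrow> p (g u) = g v \<and> g v < g u \<or> p (g v) = g u \<and> g u < g v"
    using acyclic_graph_parents[OF T] card by metis
  obtain \<phi> where \<phi>: "embeds E p {..<n} \<phi> {0..<n}"
    using full unfolding full_def by (metis card_atLeastLessThan card_lessThan diff_zero finite_lessThan)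
  define f where "f = \<phi> \<circ> g"
  have f: "bij_betw f (verts T) {0..<n}"
    unfolding f_def using g \<phi> by (auto simp: embeds_def intro: bij_betw_trans)
  have f_im: "f ` verts T = {0..<n}"
    using f by (simp add: bij_betw_def)
  have edge: "{f u, f v} \<in> E" if uv: "{u, v} \<in> edges T" for u v
  proof -
    have "g u < n" "g v < n"
      using simple_graph_edgeD[OF T(1) uv] bij_betwE[OF g] by auto
    moreover have "{\<phi> i, \<phi> (p i)} \<in> E" if "i < n" "p i < i" for i
      using that \<phi> by (simp add: embeds_def)
    ultimately show ?thesis
      using p[OF uv] unfolding f_def comp_apply by (metis insert_commute)
  qed
  have "f ` e \<in> E" if e: "e \<in> edges T" for e
  proof -
    obtain u v where "e = {u, v}"
      using T(1) e unfolding simple_graph_def by blast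
    then show ?thesis
      using edge e by simp
  qed
  then have sub: "(`) f ` edges T \<subseteq> E"
    by blast
  have "subgraph ({0..<n}, (`) f ` edges T) ({0..<n}, E)"
    using sub E unfolding subgraph_def simple_graph_def all_pairs_def by auto
  moreover have "isomorphic T ({0..<n}, (`) f ` edges T)"
    using isomorphic_image[OF T(1) bij_betw_imp_inj_on[OF f]] by (simp add: f_im)
  ultimately show "\<exists>S. subgraph S ({0..<n}, E) \<and> isomorphic T S"
    by blast
qed

theorem theorem1:
  shows "\<exists>g :: nat \<Rightarrow> real. g \<in> O(\<lambda>n. real n) \<and>
    (\<forall>\<^sub>F n in sequentially.
       real (min_universal_edges n) \<le> 19 / (6 * ln 3) * real n * ln (real n) + g n)"
proof (intro exI[of _ "\<lambda>n. 23 * real n"] conjI)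
  show "(\<lambda>n. 23 * real n) \<in> O(\<lambda>n. real n)"
    by simp
  show "\<forall>\<^sub>F n in sequentially.
      real (min_universal_edges n) \<le> 19 / (6 * ln 3) * real n * ln (real n) + 23 * real n"
    using eventually_gt_at_top[of 0]
  proof eventually_elim
    case (elim n)
    obtain E where E: "E \<subseteq> all_pairs {0..<n}" "intervals_full E 0 n"
      and card: "real (card E) \<le> 19 / 6 * (real n * log 3 n) + 23 * real n - 7"
      using interval_universal_graph[OF elim] by blast
    have "universal ({0..<n}, E) (trees n)"
      using universal_if_full[OF E(1)] intervals_fullD[OF E(2)] by simp
    moreover have "simple_graph ({0..<n}, E)"
      using E(1) by (simp add: simple_graph_def all_pairs_def)
    ultimately have "min_universal_edges n \<le> card E"
      unfolding min_universal_edges_def by (intro Least_le exI[of _ "({0..<n}, E)"]) simp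
    then have "real (min_universal_edges n) \<le> real (card E)"
      by simp
    also note card
    also have "19 / 6 * (real n * log 3 n) = 19 / (6 * ln 3) * real n * ln (real n)"
      by (simp add: log_def)
    finally show ?case
      by simp
  qed
qed

end
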